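(* Let $n\ge 1$, let $P,Q$ be $2n\times 2n$ matrices, and let $j=\begin{pmatrix}0&E\\-E&0\end{pmatrix}$, where $E$ is the $n\times n$ identity matrix. Let $\alpha$ run over a basis of $sp(n)$ and $\tilde\alpha$ over the corresponding dual basis. Then $$\sum_{\alpha}\mathrm{Tr}(P\alpha Q\tilde\alpha)=\tfrac12\bigl(\mathrm{Tr}(P)\,\mathrm{Tr}(Q)-\mathrm{Tr}(PjQ^{*}j)\bigr)$$ and $$\sum_{\alpha}\mathrm{Tr}(P\alpha)\,\mathrm{Tr}(Q\tilde\alpha)=\tfrac12\bigl(\mathrm{Tr}(PQ)+\mathrm{Tr}(PjQ^{*}j)\bigr).$$
   Context: Matrices are over a field of characteristic $0$. $sp(n)$ is the symplectic Lie algebra of $2n\times 2n$ matrices $X$ with $jX+X^{*}j=0$, with basis $E_{ii}-E_{n+i,n+i}$ ($1\le i\le n$), $E_{ij}-E_{n+j,n+i}$ ($i\ne j$), $E_{i,n+i}$, $E_{n+i,i}$ ($1\le i\le n$), $E_{i,n+j}+E_{j,n+i}$, $E_{n+i,j}+E_{n+j,i}$ ($1\le i<j\le n$), where $E_{ab}$ are matrix units; its dimension is $2n^2+n$. $Q^{*}$ denotes the transpose of $Q$, $\mathrm{Tr}$ is the ordinary trace of $2n\times2n$ matrices, and the dual basis is taken with respect to the form $\langle X,Y\rangle=\mathrm{Tr}(XY)$ on $sp(n)$. *)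

theory Defs
  imports "Jordan_Normal_Form.VS_Connect"
begin

definition mat_trace :: "'a::comm_monoid_add mat \<Rightarrow> 'a" where
  "mat_trace A = (\<Sum>i<dim_row A. A $$ (i, i))"

definition symp_J :: "nat \<Rightarrow> 'a::ring_1 mat" where
  "symp_J n = four_block_mat (0\<^sub>m n n) (1\<^sub>m n) (- 1\<^sub>m n) (0\<^sub>m n n)"

definition sp :: "nat \<Rightarrow> 'a::field mat set" where
  "sp n = {X \<in> carrier_mat (2 * n) (2 * n).
     symp_J n * X + transpose_mat X * symp_J n = 0\<^sub>m (2 * n) (2 * n)}"

definition sp_space :: "nat \<Rightarrow> ('a::field, 'a mat) module" where
  "sp_space n = (module_mat TYPE('a) (2 * n) (2 * n)) \<lparr>carrier := sp n\<rparr>"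

definition sp_basis :: "nat \<Rightarrow> 'a::field mat set \<Rightarrow> bool" where
  "sp_basis n B \<longleftrightarrow> vectorspace.basis class_ring (sp_space n) B"

text \<open>The dual basis is represented as a map \<open>d\<close> that sends each element of the basis \<open>B\<close>
  to the dual element; values of \<open>d\<close> outside \<open>B\<close> are irrelevant.\<close>

definition sp_dual_basis :: "nat \<Rightarrow> 'a::field mat set \<Rightarrow> ('a mat \<Rightarrow> 'a mat) \<Rightarrow> bool" where
  "sp_dual_basis n B d \<longleftrightarrow>
     (\<forall>\<alpha>\<in>B. d \<alpha> \<in> sp n) \<and>
     (\<forall>\<alpha>\<in>B. \<forall>\<beta>\<in>B. mat_trace (\<alpha> * d \<beta>) = (if \<alpha> = \<beta> then 1 else 0))"

text \<open>\<^const>\<open>vectorspace.basis\<close> is used above outside its locale, so the locale assumptions are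
  discharged here.\<close>

lemma symp_J_carrier [simp]: "symp_J n \<in> carrier_mat (2 * n) (2 * n)"
  unfolding symp_J_def mult_2 by (rule four_block_carrier_mat) auto

lemma vectorspace_sp_space: "vectorspace class_ring (sp_space n :: ('a::field, 'a mat) module)"
proof -
  interpret V: vectorspace class_ring "module_mat TYPE('a) (2 * n) (2 * n)"
    by (rule matrix_vs)
  have d: "dim_row (symp_J n :: 'a mat) = 2 * n" "dim_col (symp_J n :: 'a mat) = 2 * n"
    using symp_J_carrier[of n, where ?'a = 'a] by (auto simp del: symp_J_carrier)
  have J: "(symp_J n :: 'a mat) \<in> carrier_mat (2 * n) (2 * n)" by simp
  have "VectorSpace.subspace class_ring (sp n) (module_mat TYPE('a) (2 * n) (2 * n))"
  proof (intro subspace.intro submodule.intro)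
    fix v w :: "'a mat"
    assume v: "v \<in> sp n" and w: "w \<in> sp n"
    have c: "v \<in> carrier_mat (2 * n) (2 * n)" "w \<in> carrier_mat (2 * n) (2 * n)"
      using v w by (auto simp: sp_def)
    have "symp_J n * (v + w) + transpose_mat (v + w) * symp_J n =
        (symp_J n * v + symp_J n * w) + (transpose_mat v * symp_J n + transpose_mat w * symp_J n)"
      using c by (simp add: mult_add_distrib_mat[OF J] transpose_add[OF c]
          add_mult_distrib_mat[OF _ _ J])
    also have "\<dots> = (symp_J n * v + transpose_mat v * symp_J n) +
        (symp_J n * w + transpose_mat w * symp_J n)"
      using c d by (intro eq_matI) auto
    finally show "v \<oplus>\<^bsub>module_mat TYPE('a) (2 * n) (2 * n)\<^esub> w \<in> sp n"
      using v w by (simp add: sp_def module_mat_simps)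
  next
    show "\<zero>\<^bsub>module_mat TYPE('a) (2 * n) (2 * n)\<^esub> \<in> sp n"
      using right_mult_zero_mat[OF J] left_mult_zero_mat[OF J]
      by (simp add: sp_def module_mat_simps)
  next
    fix c :: 'a and v :: "'a mat"
    assume v: "v \<in> sp n"
    have cv: "v \<in> carrier_mat (2 * n) (2 * n)" using v by (auto simp: sp_def)
    have transpose_s: "transpose_mat (c \<cdot>\<^sub>m v) = c \<cdot>\<^sub>m transpose_mat v"
      by (intro eq_matI) auto
    have "symp_J n * (c \<cdot>\<^sub>m v) + transpose_mat (c \<cdot>\<^sub>m v) * symp_J n =
        c \<cdot>\<^sub>m (symp_J n * v) + c \<cdot>\<^sub>m (transpose_mat v * symp_J n)"
      using cv J d by (intro eq_matI) (auto simp: mult_smult_distrib[OF J cv] transpose_s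
          mult_smult_assoc_mat[OF _ J])
    also have "\<dots> = c \<cdot>\<^sub>m (symp_J n * v + transpose_mat v * symp_J n)"
      using cv d by (intro eq_matI) (auto simp: algebra_simps)
    finally show "c \<odot>\<^bsub>module_mat TYPE('a) (2 * n) (2 * n)\<^esub> v \<in> sp n"
      using v by (simp add: sp_def module_mat_simps)
  qed (auto simp: sp_def module_mat_simps V.vectorspace_axioms V.module_axioms)
  then show ?thesis
    unfolding sp_space_def using V.subspace_is_vs by simp
qed

end

theory Submission
  imports Defs
begin

text \<open>
  Write \<open>J\<close> for \<^term>\<open>symp_J n\<close> and \<open>\<theta>(X) = J X\<^sup>T J\<close>. Because \<open>J\<^sup>T = - J\<close> and \<open>J\<^sup>2 = - 1\<close>, the
  map \<open>\<theta>\<close> is a linear involution, the symplectic Lie algebra is its fixed space, and \<open>\<theta>\<close>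
  is self-adjoint for the form \<open>Tr(XY)\<close>. Hence \<open>(Y + \<theta>(Y)) / 2\<close> is the orthogonal projection of an
  arbitrary matrix \<open>Y\<close> to the Lie algebra.

  Let \<open>\<alpha>\<close> run over the basis and write \<open>\<alpha>~\<close> for the element dual to \<open>\<alpha>\<close>. Expanding the
  projection, with coefficients read off by the dual basis, gives
  \<open>2 \<Sum> Tr(Y \<alpha>~) \<alpha> = Y + \<theta>(Y)\<close>
  for every matrix \<open>Y\<close> (lemma \<open>sp_completeness\<close>). Both identities follow from this one. Pairing it
  with \<open>P\<close> at \<open>Y = Q\<close> gives the sum of products of traces. Taking for \<open>Y\<close> the matrix units gives
  the entries of the tensor \<open>\<Sum> \<alpha> \<otimes> \<alpha>~\<close> (lemma \<open>sp_casimir_entries\<close>), and contracting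
  these with \<open>P\<close> and \<open>Q\<close> gives the other sum; its minus sign comes from the skewness of \<open>J\<close>.

  The sums run over a set \<open>B\<close> which is only known to be a basis in the sense of finite linear
  combinations, so its finiteness has to be shown. A dual element is nonzero, hence detects some
  projected matrix unit; but each of the finitely many projected matrix units involves only finitely
  many basis elements, so \<open>B\<close> is finite.
\<close>

section \<open>Traces and entries of products\<close>

lemma mat_trace_mult:
  assumes "A \<in> carrier_mat m k" and "B \<in> carrier_mat k m"
  shows "mat_trace (A * B) = (\<Sum>i<m. \<Sum>j<k. A $$ (i, j) * B $$ (j, i))"
  using assms
  by (auto simp: mat_trace_def scalar_prod_def atLeast0LessThan intro!: sum.cong)

lemma mat_trace_mult_comm:
  fixes A B :: "'a::comm_semiring_0 mat"
  assumes "A \<in> carrier_mat m k" and "B \<in> carrier_mat k m"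
  shows "mat_trace (A * B) = mat_trace (B * A)"
  unfolding mat_trace_mult[OF assms] mat_trace_mult[OF assms(2,1)]
  by (subst sum.swap) (simp add: mult.commute)

lemma mat_trace_transpose:
  assumes "A \<in> carrier_mat m m"
  shows "mat_trace (transpose_mat A) = mat_trace A"
  using assms by (auto simp: mat_trace_def intro!: sum.cong)

lemma mat_trace_add:
  assumes "A \<in> carrier_mat m m" and "B \<in> carrier_mat m m"
  shows "mat_trace (A + B) = mat_trace A + mat_trace B"
  using assms by (simp add: mat_trace_def sum.distrib)

lemma index_mult3:
  fixes A B C :: "'a::comm_semiring_0 mat"
  assumes "A \<in> carrier_mat m m" "B \<in> carrier_mat m m" "C \<in> carrier_mat m m"
    and "i < m" "l < m"
  shows "(A * B * C) $$ (i, l) = (\<Sum>j<m. \<Sum>k<m. A $$ (i, j) * B $$ (j, k) * C $$ (k, l))"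
proof -
  have "(A * B * C) $$ (i, l) = (\<Sum>k<m. \<Sum>j<m. A $$ (i, j) * B $$ (j, k) * C $$ (k, l))"
    using assms
    by (auto simp: scalar_prod_def atLeast0LessThan sum_distrib_right simp del: assoc_mult_mat
       intro!: sum.cong)
  then show ?thesis by (rule trans[OF _ sum.swap])
qed

definition unit_mat :: "nat \<Rightarrow> nat \<Rightarrow> nat \<Rightarrow> 'a::zero_neq_one mat" where
  "unit_mat m a b = mat m m (\<lambda>(i, j). if i = a \<and> j = b then 1 else 0)"

lemma unit_mat_carrier [simp]: "unit_mat m a b \<in> carrier_mat m m"
  by (simp add: unit_mat_def)

lemma mat_trace_unit_mat_mult:
  fixes Z :: "'a::field mat"
  assumes "Z \<in> carrier_mat m m" "a < m" "b < m"
  shows "mat_trace (unit_mat m a b * Z) = Z $$ (b, a)"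
proof -
  have "mat_trace (unit_mat m a b * Z) =
      (\<Sum>i<m. \<Sum>j<m. if i = a then if j = b then Z $$ (j, i) else 0 else 0)"
    unfolding mat_trace_mult[OF unit_mat_carrier assms(1)]
    by (intro sum.cong) (auto simp: unit_mat_def)
  also have "\<dots> = (\<Sum>i<m. if i = a then Z $$ (b, i) else 0)"
    using assms by (intro sum.cong) auto
  finally show ?thesis using assms by simp
qed

section \<open>The involution fixing the symplectic Lie algebra\<close>

lemma symp_J_dim [simp]: "dim_row (symp_J n) = 2 * n" "dim_col (symp_J n) = 2 * n"
  using symp_J_carrier[of n] unfolding carrier_mat_def by blast+

lemma transpose_symp_J: "transpose_mat (symp_J n :: 'a::field mat) = - symp_J n"
  by (intro eq_matI) (auto simp: symp_J_def four_block_mat_def Let_def)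

lemma symp_J_squared: "symp_J n * symp_J n = (- 1\<^sub>m (2 * n) :: 'a::field mat)"
proof -
  have "symp_J n * symp_J n =
      (four_block_mat (- 1\<^sub>m n) (0\<^sub>m n n) (0\<^sub>m n n) (- 1\<^sub>m n) :: 'a mat)"
    unfolding symp_J_def
    by (subst mult_four_block_mat[of _ n n _ n _ n _ _ n _ n]) auto
  also have "\<dots> = - 1\<^sub>m (2 * n)"
    by (intro eq_matI) (auto simp: four_block_mat_def Let_def)
  finally show ?thesis .
qed

text \<open>Up to sign, the adjoint of \<open>X\<close> for the bilinear form with Gram matrix \<open>J\<close>: since
  \<open>inverse(J) = - J\<close>, that adjoint is \<open>inverse(J) X\<^sup>T J\<close>. The sign is chosen so that the
  Lie algebra becomes the eigenspace for \<open>1\<close>.\<close>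

definition symp_adj :: "nat \<Rightarrow> 'a::field mat \<Rightarrow> 'a mat" where
  "symp_adj n X = symp_J n * transpose_mat X * symp_J n"

lemma symp_adj_carrier [simp]:
  "X \<in> carrier_mat (2 * n) (2 * n) \<Longrightarrow> symp_adj n X \<in> carrier_mat (2 * n) (2 * n)"
  unfolding symp_adj_def
  by (intro mult_carrier_mat[of _ _ "2 * n"] symp_J_carrier) simp

lemma symp_J_left_cancel:
  fixes X :: "'a::field mat"
  assumes "X \<in> carrier_mat (2 * n) m"
  shows "symp_J n * (symp_J n * X) = - X"
proof -
  have "symp_J n * (symp_J n * X) = (symp_J n * symp_J n) * X"
    by (rule assoc_mult_mat[symmetric, OF symp_J_carrier symp_J_carrier assms])
  then show ?thesis using assms by (simp add: symp_J_squared)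
qed

lemma symp_J_right_cancel:
  fixes X :: "'a::field mat"
  assumes "X \<in> carrier_mat m (2 * n)"
  shows "X * symp_J n * symp_J n = - X"
proof -
  have "X * symp_J n * symp_J n = X * (symp_J n * symp_J n)"
    by (rule assoc_mult_mat[OF assms symp_J_carrier symp_J_carrier])
  then show ?thesis using assms by (simp add: symp_J_squared)
qed

lemma symp_adj_involution:
  fixes X :: "'a::field mat"
  assumes X: "X \<in> carrier_mat (2 * n) (2 * n)"
  shows "symp_adj n (symp_adj n X) = X"
proof -
  have "transpose_mat (symp_adj n X) =
      transpose_mat (symp_J n) * (transpose_mat (transpose_mat X) * transpose_mat (symp_J n))"
    unfolding symp_adj_def using X
    by (simp add: transpose_mult[of _ "2*n" "2*n" _ "2*n"] assoc_mult_mat[of _ "2*n" "2*n" _ "2*n" _ "2*n"])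
  also have "\<dots> = symp_J n * (X * symp_J n)"
    using X by (simp add: transpose_symp_J)
  finally have "symp_adj n (symp_adj n X) = symp_J n * (symp_J n * (X * symp_J n)) * symp_J n"
    by (simp only: symp_adj_def)
  also have "\<dots> = X"
    using X symp_J_carrier[of n]
    by (simp add: symp_J_left_cancel[of _ n "2*n"] symp_J_right_cancel del: assoc_mult_mat)
  finally show ?thesis .
qed

text \<open>Multiply the defining equation \<open>J X + X\<^sup>T J = 0\<close> by \<open>J\<close> and use \<open>J\<^sup>2 = - 1\<close>.\<close>

lemma sp_iff_symp_adj_fixed:
  fixes X :: "'a::field mat"
  shows "X \<in> sp n \<longleftrightarrow> X \<in> carrier_mat (2 * n) (2 * n) \<and> symp_adj n X = X"
proof (cases "X \<in> carrier_mat (2 * n) (2 * n)")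
  case X: True
  have XJ: "transpose_mat X * symp_J n \<in> carrier_mat (2 * n) (2 * n)"
    using X by auto
  have adj: "symp_adj n X = symp_J n * (transpose_mat X * symp_J n)"
    unfolding symp_adj_def using X by (intro assoc_mult_mat[of _ "2*n" "2*n" _ "2*n" _ "2*n"]) auto
  have "symp_J n * X + transpose_mat X * symp_J n = 0\<^sub>m (2 * n) (2 * n)
      \<longleftrightarrow> transpose_mat X * symp_J n = - (symp_J n * X)" (is "?S \<longleftrightarrow> ?T")
  proof
    assume ?S
    then have "(symp_J n * X + transpose_mat X * symp_J n) $$ (i, j) = 0"
      if "i < 2 * n" "j < 2 * n" for i j using that by simp
    then show ?T using X
      by (intro eq_matI) (auto simp: add_eq_0_iff)
  next
    assume ?T
    then show ?S using X by auto
  qed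
  also have "\<dots> \<longleftrightarrow> symp_adj n X = X"
  proof
    assume "transpose_mat X * symp_J n = - (symp_J n * X)"
    then show "symp_adj n X = X" using X by (simp add: adj symp_J_left_cancel)
  next
    assume "symp_adj n X = X"
    then have "symp_J n * X = symp_J n * (symp_J n * (transpose_mat X * symp_J n))"
      by (simp add: adj)
    also have "\<dots> = - (transpose_mat X * symp_J n)"
      using XJ by (rule symp_J_left_cancel)
    finally show "transpose_mat X * symp_J n = - (symp_J n * X)" by simp
  qed
  finally show ?thesis using X by (simp add: sp_def)
qed (simp add: sp_def)

text \<open>Twice the projection to the fixed space of the involution; the factor \<open>2\<close> is kept so that the
  division takes place only at the very end.\<close>

lemma symmetrization_in_sp:
  fixes X :: "'a::field mat"
  assumes X: "X \<in> carrier_mat (2 * n) (2 * n)"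
  shows "X + symp_adj n X \<in> sp n"
proof -
  let ?J = "symp_J n :: 'a mat"
  have "symp_adj n (X + symp_adj n X) =
      ?J * (transpose_mat X + transpose_mat (symp_adj n X)) * ?J"
    unfolding symp_adj_def[of n "X + _"] transpose_add[OF X symp_adj_carrier[OF X]] ..
  also have "\<dots> = symp_adj n X + symp_adj n (symp_adj n X)"
    unfolding symp_adj_def[of n X] symp_adj_def[of n "?J * _ * _"]
    using X by (subst mult_add_distrib_mat[of _ "2*n" "2*n" _ "2*n"])
      (auto intro!: add_mult_distrib_mat[of _ "2*n" "2*n" _ _ "2*n"] simp del: assoc_mult_mat)
  finally have "symp_adj n (X + symp_adj n X) = symp_adj n X + symp_adj n (symp_adj n X)" .
  then show ?thesis
    using X comm_add_mat[OF X symp_adj_carrier[OF X]]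
    by (simp add: sp_iff_symp_adj_fixed symp_adj_involution)
qed

text \<open>Cyclicity moves both copies of \<open>J\<close> to \<open>Z\<close>, and transposing under the trace moves the
  transpose there as well, producing \<^term>\<open>symp_adj n Z\<close>, which is \<open>Z\<close>.\<close>

lemma mat_trace_symp_adj:
  fixes X Z :: "'a::field mat"
  assumes X: "X \<in> carrier_mat (2 * n) (2 * n)" and Z: "Z \<in> sp n"
  shows "mat_trace (symp_adj n X * Z) = mat_trace (X * Z)"
proof -
  have Zc: "Z \<in> carrier_mat (2 * n) (2 * n)" and Zfix: "symp_adj n Z = Z"
    using Z by (auto simp: sp_iff_symp_adj_fixed)
  let ?J = "symp_J n :: 'a mat"
  have "mat_trace (symp_adj n X * Z) = mat_trace (?J * (transpose_mat X * ?J * Z))"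
    using X Zc by (simp add: symp_adj_def assoc_mult_mat[of _ "2*n" "2*n" _ "2*n" _ "2*n"])
  also have "\<dots> = mat_trace (transpose_mat X * ?J * Z * ?J)"
    using X Zc by (intro mat_trace_mult_comm[of _ "2*n" "2*n"]) auto
  also have "\<dots> = mat_trace (transpose_mat (transpose_mat X * (?J * Z * ?J)))"
    using X Zc by (subst mat_trace_transpose[of _ "2*n"])
      (simp_all add: assoc_mult_mat[of _ "2*n" "2*n" _ "2*n" _ "2*n"]
        mult_carrier_mat[of _ "2*n" "2*n" _ "2*n"])
  also have "transpose_mat (transpose_mat X * (?J * Z * ?J)) =
      transpose_mat ?J * (transpose_mat Z * transpose_mat ?J) * X"
    using X Zc
    by (simp add: transpose_mult[of _ "2*n" "2*n" _ "2*n"] mult_carrier_mat[of _ "2*n" "2*n" _ "2*n"]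
        del: assoc_mult_mat)
  also have "\<dots> = symp_adj n Z * X"
    using Zc unfolding transpose_symp_J symp_adj_def
    by (simp add: assoc_mult_mat[of _ "2*n" "2*n" _ "2*n" _ "2*n"])
  also have "mat_trace (symp_adj n Z * X) = mat_trace (X * Z)"
    unfolding Zfix by (rule mat_trace_mult_comm[OF Zc X])
  finally show ?thesis .
qed

lemma index_symp_adj_unit_mat:
  assumes "a < 2 * n" "b < 2 * n" "i < 2 * n" "j < 2 * n"
  shows "symp_adj n (unit_mat (2 * n) a b) $$ (i, j) =
      (symp_J n $$ (i, b) * symp_J n $$ (a, j) :: 'a::field)"
proof -
  have "symp_adj n (unit_mat (2 * n) a b) $$ (i, j) =
      (\<Sum>k<2 * n. \<Sum>l<2 * n. symp_J n $$ (i, k) * transpose_mat (unit_mat (2 * n) a b) $$ (k, l) * symp_J n $$ (l, j) :: 'a)"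
    unfolding symp_adj_def using assms by (intro index_mult3) auto
  also have "\<dots> = (\<Sum>k<2 * n. \<Sum>l<2 * n. if k = b then if l = a then
      symp_J n $$ (i, k) * symp_J n $$ (l, j) else 0 else 0)"
    by (intro sum.cong) (auto simp: unit_mat_def)
  also have "\<dots> = (\<Sum>k<2 * n. if k = b then symp_J n $$ (i, k) * symp_J n $$ (a, j) else 0)"
    using assms by (intro sum.cong) auto
  finally show ?thesis using assms by simp
qed

section \<open>Expansion in a basis and its dual\<close>

text \<open>The passage from abstract linear combinations in the module \<^term>\<open>sp_space n\<close> to ordinary
  finite sums of entries.\<close>

lemma sp_span_entries:
  fixes B :: "'a::field mat set"
  assumes basis: "sp_basis n B" and X: "X \<in> sp n"
  obtains S c where "finite S" "S \<subseteq> B"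
    "\<And>i j. i < 2 * n \<Longrightarrow> j < 2 * n \<Longrightarrow> X $$ (i, j) = (\<Sum>\<alpha>\<in>S. c \<alpha> * \<alpha> $$ (i, j))"
proof -
  interpret V: vectorspace class_ring "sp_space n :: ('a, 'a mat) module"
    by (rule vectorspace_sp_space)
  note ops = sp_space_def module_mat_def
  have B: "V.gen_set B" "B \<subseteq> sp n"
    using basis unfolding sp_basis_def V.basis_def by (auto simp: ops)
  then have "X \<in> V.span B" using X by (simp add: ops)
  then obtain c S where S: "finite S" "S \<subseteq> B" and X_eq: "X = V.lincomb c S"
    unfolding V.span_def by auto
  have "V.lincomb c S \<in> carrier_mat (2 * n) (2 * n) \<and> (\<forall>i<2 * n. \<forall>j<2 * n.
      V.lincomb c S $$ (i, j) = (\<Sum>\<alpha>\<in>S. c \<alpha> * \<alpha> $$ (i, j)))"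
    using S
  proof (induction S rule: finite_induct)
    case empty
    have "V.lincomb c {} = 0\<^sub>m (2 * n) (2 * n)"
      unfolding V.lincomb_def V.finsum_empty by (simp add: ops)
    then show ?case by simp
  next
    case (insert \<beta> F)
    have c: "\<beta> \<in> carrier_mat (2 * n) (2 * n)" using insert.prems B by (auto simp: sp_def)
    have "V.lincomb c (insert \<beta> F) = c \<beta> \<odot>\<^bsub>sp_space n\<^esub> \<beta> \<oplus>\<^bsub>sp_space n\<^esub> V.lincomb c F"
      using insert.hyps insert.prems B
      by (intro V.lincomb_insert2) (auto simp: ops)
    then have "V.lincomb c (insert \<beta> F) = c \<beta> \<cdot>\<^sub>m \<beta> + V.lincomb c F"
      by (simp add: ops)
    moreover have F: "V.lincomb c F \<in> carrier_mat (2 * n) (2 * n)"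
      using insert by blast
    moreover have "(c \<beta> \<cdot>\<^sub>m \<beta> + V.lincomb c F) $$ (i, j) =
        c \<beta> * \<beta> $$ (i, j) + V.lincomb c F $$ (i, j)" if "i < 2 * n" "j < 2 * n" for i j
      using c carrier_matD[OF F] that by simp
    ultimately show ?case using insert c by simp
  qed
  then have entries: "\<forall>i<2 * n. \<forall>j<2 * n. X $$ (i, j) = (\<Sum>\<alpha>\<in>S. c \<alpha> * \<alpha> $$ (i, j))"
    unfolding X_eq by blast
  show thesis
  proof (rule that[OF S])
    show "X $$ (i, j) = (\<Sum>\<alpha>\<in>S. c \<alpha> * \<alpha> $$ (i, j))" if "i < 2 * n" "j < 2 * n" for i j
      using entries that by blast
  qed
qed

lemma sp_basis_carrier:
  fixes B :: "'a::field mat set"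
  assumes basis: "sp_basis n B" and "\<alpha> \<in> B"
  shows "\<alpha> \<in> carrier_mat (2 * n) (2 * n)"
proof -
  have "B \<subseteq> carrier (sp_space n)"
    using basis
    unfolding sp_basis_def vectorspace.basis_def[OF vectorspace_sp_space] by blast
  then show ?thesis using assms(2) by (auto simp: sp_space_def sp_def)
qed

lemma dual_in_sp: "sp_dual_basis n B dual \<Longrightarrow> \<alpha> \<in> B \<Longrightarrow> dual \<alpha> \<in> sp n"
  unfolding sp_dual_basis_def by blast

lemma dual_carrier:
  "sp_dual_basis n B dual \<Longrightarrow> \<alpha> \<in> B \<Longrightarrow> dual \<alpha> \<in> carrier_mat (2 * n) (2 * n)"
  using dual_in_sp[of n B dual \<alpha>] unfolding sp_def by blast

lemma mat_trace_dual:
  "sp_dual_basis n B dual \<Longrightarrow> \<alpha> \<in> B \<Longrightarrow> \<beta> \<in> B \<Longrightarrow>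
    mat_trace (\<alpha> * dual \<beta>) = (if \<alpha> = \<beta> then 1 else 0)"
  unfolding sp_dual_basis_def by blast

text \<open>Pairing a finite expansion of \<open>X\<close> with the dual elements identifies its coefficients, so the
  basis elements on which \<open>X\<close> has nonzero coefficient are among those of the expansion. Summing over
  exactly these keeps the statement meaningful while \<open>B\<close> is not yet known to be finite.\<close>

lemma finite_dual_expansion:
  fixes B :: "'a::field mat set"
  assumes basis: "sp_basis n B" and dual: "sp_dual_basis n B dual" and X: "X \<in> sp n"
  shows "finite {\<alpha> \<in> B. mat_trace (X * dual \<alpha>) \<noteq> 0}" (is "finite ?supp")
    and "i < 2 * n \<Longrightarrow> j < 2 * n \<Longrightarrow> X $$ (i, j) =
      (\<Sum>\<alpha> | \<alpha> \<in> B \<and> mat_trace (X * dual \<alpha>) \<noteq> 0. mat_trace (X * dual \<alpha>) * \<alpha> $$ (i, j))"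
proof -
  obtain S c where S: "finite S" "S \<subseteq> B" and entries:
    "\<And>i j. i < 2 * n \<Longrightarrow> j < 2 * n \<Longrightarrow> X $$ (i, j) = (\<Sum>\<alpha>\<in>S. c \<alpha> * \<alpha> $$ (i, j))"
    using sp_span_entries[OF basis X] by blast
  have Xc: "X \<in> carrier_mat (2 * n) (2 * n)" using X by (simp add: sp_def)
  have coeff: "mat_trace (X * dual \<beta>) = (if \<beta> \<in> S then c \<beta> else 0)" if \<beta>: "\<beta> \<in> B" for \<beta>
  proof -
    have "mat_trace (X * dual \<beta>) =
        (\<Sum>i<2 * n. \<Sum>j<2 * n. \<Sum>\<alpha>\<in>S. c \<alpha> * (\<alpha> $$ (i, j) * dual \<beta> $$ (j, i)))"
      by (simp add: mat_trace_mult[OF Xc dual_carrier[OF dual \<beta>]] entries sum_distrib_right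
          mult.assoc)
    also have "\<dots> = (\<Sum>\<alpha>\<in>S. \<Sum>i<2 * n. \<Sum>j<2 * n. c \<alpha> * (\<alpha> $$ (i, j) * dual \<beta> $$ (j, i)))"
      by (simp only: sum.swap[of _ S "{..<2 * n}"])
    also have "\<dots> = (\<Sum>\<alpha>\<in>S. c \<alpha> * mat_trace (\<alpha> * dual \<beta>))"
      using S \<beta> by (intro sum.cong)
        (auto simp: mat_trace_mult[OF sp_basis_carrier[OF basis] dual_carrier[OF dual]]
          sum_distrib_left)
    also have "\<dots> = (\<Sum>\<alpha>\<in>S. if \<alpha> = \<beta> then c \<alpha> else 0)"
      using S \<beta> by (intro sum.cong) (auto simp: mat_trace_dual[OF dual])
    finally show ?thesis using S(1) by simp
  qed
  have supp: "?supp \<subseteq> S" using coeff by (auto split: if_splits)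
  then show "finite ?supp" using S(1) by (rule finite_subset)
  assume ij: "i < 2 * n" "j < 2 * n"
  have "X $$ (i, j) = (\<Sum>\<alpha>\<in>S. mat_trace (X * dual \<alpha>) * \<alpha> $$ (i, j))"
    unfolding entries[OF ij] using S coeff by (intro sum.cong) auto
  also have "\<dots> = (\<Sum>\<alpha>\<in>?supp. mat_trace (X * dual \<alpha>) * \<alpha> $$ (i, j))"
    using S supp by (intro sum.mono_neutral_right) auto
  finally show "X $$ (i, j) = (\<Sum>\<alpha>\<in>?supp. mat_trace (X * dual \<alpha>) * \<alpha> $$ (i, j))" .
qed

text \<open>Elements of the Lie algebra do not distinguish a matrix from its projection.\<close>

lemma mat_trace_symmetrization_dual:
  fixes B :: "'a::field mat set"
  assumes dual: "sp_dual_basis n B dual"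
    and Y: "Y \<in> carrier_mat (2 * n) (2 * n)" and \<alpha>: "\<alpha> \<in> B"
  shows "mat_trace ((Y + symp_adj n Y) * dual \<alpha>) = 2 * mat_trace (Y * dual \<alpha>)"
proof -
  note Y' = symp_adj_carrier[OF Y] and d = dual_carrier[OF dual \<alpha>]
  have "mat_trace ((Y + symp_adj n Y) * dual \<alpha>) =
      mat_trace (Y * dual \<alpha>) + mat_trace (symp_adj n Y * dual \<alpha>)"
    unfolding add_mult_distrib_mat[OF Y Y' d]
    by (rule mat_trace_add[OF mult_carrier_mat[OF Y d] mult_carrier_mat[OF Y' d]])
  then show ?thesis by (simp add: mat_trace_symp_adj[OF Y dual_in_sp[OF dual \<alpha>]])
qed

text \<open>Each \<open>\<beta>\<close> in \<open>B\<close> has a dual element with a nonzero entry, and this entry is the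
  coefficient of \<open>\<beta>\<close> in a projected matrix unit. So \<open>B\<close> is covered by the supports of the
  finitely many projected matrix units, each of which is finite.\<close>

lemma finite_sp_basis:
  fixes B :: "'a::field_char_0 mat set"
  assumes basis: "sp_basis n B" and dual: "sp_dual_basis n B dual"
  shows "finite B"
proof -
  let ?G = "\<lambda>a b. unit_mat (2 * n) a b + symp_adj n (unit_mat (2 * n) a b) :: 'a mat"
  let ?supp = "\<lambda>a b. {\<beta> \<in> B. mat_trace (?G a b * dual \<beta>) \<noteq> 0}"
  have "finite (?supp a b)" for a b
    by (rule finite_dual_expansion(1)[OF basis dual symmetrization_in_sp[OF unit_mat_carrier]])
  moreover have "B \<subseteq> (\<Union>a<2 * n. \<Union>b<2 * n. ?supp a b)"
  proof
    fix \<beta> assume \<beta>: "\<beta> \<in> B"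
    have "\<exists>i<2 * n. \<exists>j<2 * n. dual \<beta> $$ (j, i) \<noteq> 0"
    proof (rule ccontr)
      assume "\<not> ?thesis"
      then have "mat_trace (\<beta> * dual \<beta>) = 0"
        by (simp add: mat_trace_mult[OF sp_basis_carrier[OF basis \<beta>] dual_carrier[OF dual \<beta>]])
      then show False using mat_trace_dual[OF dual \<beta> \<beta>] by simp
    qed
    then obtain a b where "a < 2 * n" "b < 2 * n" "dual \<beta> $$ (b, a) \<noteq> 0" by blast
    moreover from this have "mat_trace (?G a b * dual \<beta>) \<noteq> 0"
      using \<beta> by (simp add: mat_trace_symmetrization_dual[OF dual]
          mat_trace_unit_mat_mult dual_carrier[OF dual])
    ultimately show "\<beta> \<in> (\<Union>a<2 * n. \<Union>b<2 * n. ?supp a b)" using \<beta> by blast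
  qed
  ultimately show ?thesis by (auto intro: finite_subset)
qed

section \<open>The completeness relation and the trace identities\<close>

text \<open>The expansion of the projection of \<open>Y\<close>: its coefficients can be computed from \<open>Y\<close> itself.\<close>

lemma sp_completeness:
  fixes B :: "'a::field_char_0 mat set"
  assumes basis: "sp_basis n B" and dual: "sp_dual_basis n B dual"
    and Y: "Y \<in> carrier_mat (2 * n) (2 * n)" and ij: "i < 2 * n" "j < 2 * n"
  shows "2 * (\<Sum>\<alpha>\<in>B. mat_trace (Y * dual \<alpha>) * \<alpha> $$ (i, j)) =
      Y $$ (i, j) + symp_adj n Y $$ (i, j)"
proof -
  let ?G = "Y + symp_adj n Y"
  \<comment> \<open>With \<open>B\<close> finite, the sum over the support may be extended by zeros to all of \<open>B\<close>.\<close>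
  note finite_dual_expansion(2)[OF basis dual symmetrization_in_sp[OF Y] ij]
  also have "(\<Sum>\<alpha> | \<alpha> \<in> B \<and> mat_trace (?G * dual \<alpha>) \<noteq> 0. mat_trace (?G * dual \<alpha>) * \<alpha> $$ (i, j)) =
      (\<Sum>\<alpha>\<in>B. mat_trace (?G * dual \<alpha>) * \<alpha> $$ (i, j))"
    using finite_sp_basis[OF basis dual] by (intro sum.mono_neutral_left) auto
  also have "\<dots> = 2 * (\<Sum>\<alpha>\<in>B. mat_trace (Y * dual \<alpha>) * \<alpha> $$ (i, j))"
    by (simp add: mat_trace_symmetrization_dual[OF dual Y] sum_distrib_left mult.assoc)
  finally show ?thesis using Y symp_adj_carrier[OF Y] ij by simp
qed

text \<open>Completeness at \<open>Y = Q\<close>, multiplied by the entries of \<open>P\<close> and summed.\<close>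

lemma sp_sum_trace_mult_trace:
  fixes B :: "'a::field_char_0 mat set"
  assumes basis: "sp_basis n B" and dual: "sp_dual_basis n B dual"
    and P: "P \<in> carrier_mat (2 * n) (2 * n)" and Q: "Q \<in> carrier_mat (2 * n) (2 * n)"
  shows "2 * (\<Sum>\<alpha>\<in>B. mat_trace (P * \<alpha>) * mat_trace (Q * dual \<alpha>)) =
      mat_trace (P * Q) + mat_trace (P * symp_adj n Q)"
proof -
  have "2 * (\<Sum>\<alpha>\<in>B. mat_trace (P * \<alpha>) * mat_trace (Q * dual \<alpha>)) =
      (\<Sum>\<alpha>\<in>B. \<Sum>i<2 * n. \<Sum>j<2 * n.
        P $$ (i, j) * (2 * (mat_trace (Q * dual \<alpha>) * \<alpha> $$ (j, i))))"
    by (simp add: mat_trace_mult[OF P sp_basis_carrier[OF basis]] sum_distrib_left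
        sum_distrib_right) (simp add: mult_ac)
  also have "\<dots> = (\<Sum>i<2 * n. \<Sum>j<2 * n. \<Sum>\<alpha>\<in>B.
        P $$ (i, j) * (2 * (mat_trace (Q * dual \<alpha>) * \<alpha> $$ (j, i))))"
    by (simp only: sum.swap[of _ "{..<2 * n}" B])
  also have "\<dots> = (\<Sum>i<2 * n. \<Sum>j<2 * n. P $$ (i, j) *
      (Q $$ (j, i) + symp_adj n Q $$ (j, i)))"
    by (simp add: sum_distrib_left[symmetric] sp_completeness[OF basis dual Q])
  also have "\<dots> = mat_trace (P * Q) + mat_trace (P * symp_adj n Q)"
    by (simp add: mat_trace_mult[OF P Q] mat_trace_mult[OF P symp_adj_carrier[OF Q]]
        distrib_left sum.distrib)
  finally show ?thesis .
qed

text \<open>Completeness at a matrix unit \<open>Y\<close>, for which \<open>Tr(Y Z)\<close> picks out one entry of \<open>Z\<close>.\<close>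

lemma sp_casimir_entries:
  fixes B :: "'a::field_char_0 mat set"
  assumes basis: "sp_basis n B" and dual: "sp_dual_basis n B dual"
    and "i < 2 * n" "j < 2 * n" "k < 2 * n" "l < 2 * n"
  shows "2 * (\<Sum>\<alpha>\<in>B. \<alpha> $$ (i, j) * dual \<alpha> $$ (k, l)) =
      (if i = l \<and> j = k then 1 else 0) + symp_J n $$ (i, k) * symp_J n $$ (l, j)"
proof -
  have entry: "mat_trace (unit_mat (2 * n) l k * dual \<alpha>) = dual \<alpha> $$ (k, l)" if "\<alpha> \<in> B" for \<alpha>
    by (rule mat_trace_unit_mat_mult[OF dual_carrier[OF dual that] assms(6,5)])
  have "2 * (\<Sum>\<alpha>\<in>B. \<alpha> $$ (i, j) * dual \<alpha> $$ (k, l)) =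
      2 * (\<Sum>\<alpha>\<in>B. mat_trace (unit_mat (2 * n) l k * dual \<alpha>) * \<alpha> $$ (i, j))"
    by (simp only: mult.commute[of "_ $$ (i, j)"] entry cong: sum.cong)
  also have "\<dots> = unit_mat (2 * n) l k $$ (i, j) + symp_adj n (unit_mat (2 * n) l k) $$ (i, j)"
    using assms(3,4) by (intro sp_completeness[OF basis dual]) auto
  finally show ?thesis
    using assms(3-) by (simp add: index_symp_adj_unit_mat) (simp add: unit_mat_def)
qed

text \<open>In the index sum for \<open>Tr(P \<alpha> Q \<alpha>~)\<close> the Kronecker deltas of the tensor
  close \<open>P\<close> and \<open>Q\<close> to separate traces, while the two entries of \<open>J\<close> link them into the
  trace of \<open>P J Q\<^sup>T J\<close>. One of these entries appears with its indices in the wrong order, and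
  exchanging them costs the sign.\<close>

lemma sp_sum_trace_sandwich:
  fixes B :: "'a::field_char_0 mat set"
  assumes basis: "sp_basis n B" and dual: "sp_dual_basis n B dual"
    and P: "P \<in> carrier_mat (2 * n) (2 * n)" and Q: "Q \<in> carrier_mat (2 * n) (2 * n)"
  shows "2 * (\<Sum>\<alpha>\<in>B. mat_trace (P * \<alpha> * Q * dual \<alpha>)) =
      mat_trace P * mat_trace Q - mat_trace (P * symp_adj n Q)"
proof -
  let ?N = "{..<2 * n}" and ?J = "symp_J n :: 'a mat"
  have J_skew: "?J $$ (k, i) = - ?J $$ (i, k)" if "i < 2 * n" "k < 2 * n" for i k
    using that arg_cong[OF transpose_symp_J[of n, where ?'a = 'a], of "\<lambda>M. M $$ (i, k)"] by simp
  have adj_entry: "symp_adj n Q $$ (j, i) =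
      (\<Sum>l\<in>?N. \<Sum>k\<in>?N. ?J $$ (j, l) * transpose_mat Q $$ (l, k) * ?J $$ (k, i))"
    if "j < 2 * n" "i < 2 * n" for i j
    unfolding symp_adj_def using Q that by (intro index_mult3) auto
  have trace: "mat_trace (P * \<alpha> * Q * dual \<alpha>) = (\<Sum>i\<in>?N. \<Sum>l\<in>?N. \<Sum>j\<in>?N. \<Sum>k\<in>?N.
      P $$ (i, j) * Q $$ (k, l) * (\<alpha> $$ (j, k) * dual \<alpha> $$ (l, i)))" if \<alpha>: "\<alpha> \<in> B" for \<alpha>
  proof -
    note \<alpha>c = sp_basis_carrier[OF basis \<alpha>]
    have "mat_trace (P * \<alpha> * Q * dual \<alpha>) =
        (\<Sum>i\<in>?N. \<Sum>l\<in>?N. (P * \<alpha> * Q) $$ (i, l) * dual \<alpha> $$ (l, i))"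
      using P Q \<alpha>c dual_carrier[OF dual \<alpha>] by (intro mat_trace_mult) auto
    then show ?thesis
      by (simp add: index_mult3[OF P \<alpha>c Q] sum_distrib_right del: assoc_mult_mat)
        (simp add: mult_ac)
  qed
  have "2 * (\<Sum>\<alpha>\<in>B. mat_trace (P * \<alpha> * Q * dual \<alpha>)) =
      (\<Sum>\<alpha>\<in>B. \<Sum>i\<in>?N. \<Sum>l\<in>?N. \<Sum>j\<in>?N. \<Sum>k\<in>?N.
        P $$ (i, j) * Q $$ (k, l) * (2 * (\<alpha> $$ (j, k) * dual \<alpha> $$ (l, i))))"
    by (simp add: trace sum_distrib_left del: assoc_mult_mat) (simp add: mult_ac)
  also have "\<dots> = (\<Sum>i\<in>?N. \<Sum>l\<in>?N. \<Sum>j\<in>?N. \<Sum>k\<in>?N. \<Sum>\<alpha>\<in>B.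
        P $$ (i, j) * Q $$ (k, l) * (2 * (\<alpha> $$ (j, k) * dual \<alpha> $$ (l, i))))"
    by (simp only: sum.swap[of _ ?N B])
  also have "\<dots> = (\<Sum>i\<in>?N. \<Sum>l\<in>?N. \<Sum>j\<in>?N. \<Sum>k\<in>?N. P $$ (i, j) * Q $$ (k, l) *
        ((if j = i \<and> k = l then 1 else 0) + ?J $$ (j, l) * ?J $$ (i, k)))"
    by (simp add: sum_distrib_left[symmetric] sp_casimir_entries[OF basis dual])
  also have "\<dots> = (\<Sum>i\<in>?N. \<Sum>l\<in>?N. \<Sum>j\<in>?N. \<Sum>k\<in>?N.
         if j = i then if k = l then P $$ (i, j) * Q $$ (k, l) else 0 else 0) -
      (\<Sum>i\<in>?N. \<Sum>l\<in>?N. \<Sum>j\<in>?N. \<Sum>k\<in>?N.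
         P $$ (i, j) * (?J $$ (j, l) * transpose_mat Q $$ (l, k) * ?J $$ (k, i)))"
    unfolding sum_subtractf[symmetric]
  proof (intro sum.cong refl)
    fix i l j k assume "i \<in> ?N" "l \<in> ?N" "j \<in> ?N" "k \<in> ?N"
    then have "?J $$ (k, i) = - ?J $$ (i, k)" "transpose_mat Q $$ (l, k) = Q $$ (k, l)"
      using J_skew[of i k] Q by auto
    then show "P $$ (i, j) * Q $$ (k, l) *
          ((if j = i \<and> k = l then 1 else 0) + ?J $$ (j, l) * ?J $$ (i, k)) =
        (if j = i then if k = l then P $$ (i, j) * Q $$ (k, l) else 0 else 0) -
        P $$ (i, j) * (?J $$ (j, l) * transpose_mat Q $$ (l, k) * ?J $$ (k, i))"
      by (simp add: algebra_simps)
  qed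
  also have "(\<Sum>i\<in>?N. \<Sum>l\<in>?N. \<Sum>j\<in>?N. \<Sum>k\<in>?N.
         if j = i then if k = l then P $$ (i, j) * Q $$ (k, l) else 0 else 0) =
      (\<Sum>i\<in>?N. \<Sum>l\<in>?N. \<Sum>j\<in>?N. if j = i then P $$ (i, j) * Q $$ (l, l) else 0)"
    by (intro sum.cong refl) auto
  also have "\<dots> = mat_trace P * mat_trace Q"
    using P Q by (simp add: mat_trace_def sum_product)
  also have "(\<Sum>i\<in>?N. \<Sum>l\<in>?N. \<Sum>j\<in>?N. \<Sum>k\<in>?N.
         P $$ (i, j) * (?J $$ (j, l) * transpose_mat Q $$ (l, k) * ?J $$ (k, i))) =
      (\<Sum>i\<in>?N. \<Sum>j\<in>?N. \<Sum>l\<in>?N. \<Sum>k\<in>?N.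
         P $$ (i, j) * (?J $$ (j, l) * transpose_mat Q $$ (l, k) * ?J $$ (k, i)))"
    by (intro sum.cong refl sum.swap)
  also have "\<dots> = mat_trace (P * symp_adj n Q)"
    by (simp add: mat_trace_mult[OF P symp_adj_carrier[OF Q]] adj_entry sum_distrib_left)
  finally show ?thesis .
qed

theorem lemma4:
  fixes n :: nat and P Q :: "'a::field_char_0 mat" and B :: "'a mat set"
    and dual :: "'a mat \<Rightarrow> 'a mat"
  assumes "n \<ge> 1"
    and "P \<in> carrier_mat (2 * n) (2 * n)"
    and "Q \<in> carrier_mat (2 * n) (2 * n)"
    and "sp_basis n B"
    and "sp_dual_basis n B dual"
  shows "(\<Sum>\<alpha>\<in>B. mat_trace (P * \<alpha> * Q * dual \<alpha>)) =
           1 / 2 * (mat_trace P * mat_trace Q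
                    - mat_trace (P * symp_J n * transpose_mat Q * symp_J n))
       \<and> (\<Sum>\<alpha>\<in>B. mat_trace (P * \<alpha>) * mat_trace (Q * dual \<alpha>)) =
           1 / 2 * (mat_trace (P * Q)
                    + mat_trace (P * symp_J n * transpose_mat Q * symp_J n))"
proof -
  have Qt: "transpose_mat Q \<in> carrier_mat (2 * n) (2 * n)"
    using assms(3) by simp
  have "P * symp_J n * transpose_mat Q * symp_J n =
      P * (symp_J n * transpose_mat Q) * symp_J n"
    by (simp only: assoc_mult_mat[OF assms(2) symp_J_carrier Qt])
  also have "\<dots> = P * symp_adj n Q"
    unfolding symp_adj_def
    by (rule assoc_mult_mat[OF assms(2) mult_carrier_mat[OF symp_J_carrier Qt] symp_J_carrier])
  finally have adj: "P * symp_J n * transpose_mat Q * symp_J n = P * symp_adj n Q" .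
  have halve: "x = 1 / 2 * y" if "2 * x = y" for x y :: 'a
    using that by auto
  show ?thesis
    unfolding adj
    by (intro conjI halve sp_sum_trace_sandwich[OF assms(4,5,2,3)]
        sp_sum_trace_mult_trace[OF assms(4,5,2,3)])
qed

end
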